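(* Let $k\geq 3$. For random $k$-SAT there exists $\eta>0$ such that for every sequence $p=p(n)\in[0,1]$, \[ \lim_{n\to\infty}\Pr_{p=p(n)}[\Phi\in SAT]=0 \;\Longrightarrow\; \lim_{n\to\infty}\Pr_{p=p(n)}\Big[\frac{|Spine(\Phi)|}{n}\geq \eta\Big]=1 . \]
   Context: Random $k$-SAT in the constant probability model: on $n$ Boolean variables, each of the $2^k\binom{n}{k}$ possible $k$-clauses (disjunctions of $k$ literals on $k$ distinct variables) is included in the random formula $\Phi$ independently with probability $p$. $SAT$ denotes the set of satisfiable formulas. For a CNF formula $\Phi$, its spine is the set of literals $Spine(\Phi)=\{x \text{ a literal} : \exists\, \Xi\subseteq\Phi \text{ (a subset of the clauses) with } \Xi \text{ satisfiable and } \Xi\wedge\{\overline{x}\} \text{ unsatisfiable}\}$. *)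

theory Defs
  imports "HOL-Probability.Probability"
begin

datatype literal = Pos nat | Neg nat

fun atom :: "literal \<Rightarrow> nat" where
  "atom (Pos v) = v"
| "atom (Neg v) = v"

fun compl :: "literal \<Rightarrow> literal" where
  "compl (Pos v) = Neg v"
| "compl (Neg v) = Pos v"

text \<open>A clause is the disjunction of a set of literals, a CNF formula the conjunction of a set
  of clauses. In particular the empty clause is false and the empty formula is true.\<close>

type_synonym clause = "literal set"
type_synonym cnf = "clause set"

fun lit_true :: "(nat \<Rightarrow> bool) \<Rightarrow> literal \<Rightarrow> bool" where
  "lit_true \<sigma> (Pos v) \<longleftrightarrow> \<sigma> v"
| "lit_true \<sigma> (Neg v) \<longleftrightarrow> \<not> \<sigma> v"

definition models :: "(nat \<Rightarrow> bool) \<Rightarrow> cnf \<Rightarrow> bool" where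
  "models \<sigma> \<Phi> \<longleftrightarrow> (\<forall>C\<in>\<Phi>. \<exists>l\<in>C. lit_true \<sigma> l)"

definition SAT :: "cnf set" where
  "SAT = {\<Phi>. \<exists>\<sigma>. models \<sigma> \<Phi>}"

text \<open>The literal \<open>x\<close> is not restricted to the variables of \<open>\<Phi>\<close>: if \<open>\<Xi>\<close> is satisfiable and
  does not contain \<open>x\<close> in any clause, then \<open>\<Xi>\<close> together with the unit clause of \<open>compl x\<close> is
  satisfiable as well, so only literals occurring in \<open>\<Phi>\<close> can belong to the spine.\<close>

definition spine :: "cnf \<Rightarrow> literal set" where
  "spine \<Phi> = {x. \<exists>\<Xi>\<subseteq>\<Phi>. \<Xi> \<in> SAT \<and> insert {compl x} \<Xi> \<notin> SAT}"

definition kclauses :: "nat \<Rightarrow> nat \<Rightarrow> clause set" where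
  "kclauses k n = {C. card C = k \<and> finite C \<and> inj_on atom C \<and> atom ` C \<subseteq> {..<n}}"

definition random_ksat :: "nat \<Rightarrow> nat \<Rightarrow> real \<Rightarrow> cnf pmf" where
  "random_ksat k n p =
     map_pmf (\<lambda>f. {C \<in> kclauses k n. f C}) (Pi_pmf (kclauses k n) False (\<lambda>_. bernoulli_pmf p))"

lemma spine_subset_Union: "spine \<Phi> \<subseteq> \<Union>\<Phi>"
proof
  fix x assume "x \<in> spine \<Phi>"
  then obtain \<Xi> \<sigma> where X: "\<Xi> \<subseteq> \<Phi>" "models \<sigma> \<Xi>" "insert {compl x} \<Xi> \<notin> SAT"
    by (auto simp: spine_def SAT_def)
  show "x \<in> \<Union>\<Phi>"
  proof (rule ccontr)
    assume nx: "x \<notin> \<Union>\<Phi>"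
    define \<tau> where "\<tau> = \<sigma>(atom x := (case x of Pos _ \<Rightarrow> False | Neg _ \<Rightarrow> True))"
    have tc: "lit_true \<tau> (compl x)"
      by (cases x) (auto simp: \<tau>_def)
    have tl: "lit_true \<tau> l" if "lit_true \<sigma> l" "l \<noteq> x" for l
      using that by (cases x; cases l) (auto simp: \<tau>_def)
    have "models \<tau> (insert {compl x} \<Xi>)"
      unfolding models_def
    proof
      fix C assume "C \<in> insert {compl x} \<Xi>"
      then consider "C = {compl x}" | "C \<in> \<Xi>" by blast
      then show "\<exists>l\<in>C. lit_true \<tau> l"
      proof cases
        case 1
        then show ?thesis using tc by simp
      next
        case 2
        then obtain l where l: "l \<in> C" "lit_true \<sigma> l" using X(2) unfolding models_def by blast
        have "l \<noteq> x" using l(1) 2 X(1) nx by blast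
        then show ?thesis using tl l by blast
      qed
    qed
    with X(3) show False
      by (auto simp: SAT_def)
  qed
qed

lemma kclauses_eq_image:
  "kclauses k n = (\<lambda>(V, S). Pos ` S \<union> Neg ` (V - S)) `
     (SIGMA V : {V. V \<subseteq> {..<n} \<and> card V = k}. Pow V)" (is "_ = ?h ` ?A")
proof
  show "kclauses k n \<subseteq> ?h ` ?A"
  proof
    fix C assume C: "C \<in> kclauses k n"
    define S where "S = {v. Pos v \<in> C}"
    have inj: "inj_on atom C" using C by (simp add: kclauses_def)
    have "x \<in> C \<longleftrightarrow> x \<in> Pos ` S \<union> Neg ` (atom ` C - S)" for x
    proof (cases x)
      case (Pos v)
      then show ?thesis by (auto simp: S_def)
    next
      case (Neg v)
      have 1: "v \<notin> S" if "Neg v \<in> C"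
        using inj_onD[OF inj, of "Pos v" "Neg v"] that by (auto simp: S_def)
      have 2: "v \<in> atom ` C" if "Neg v \<in> C"
        using imageI[OF that, of atom] by simp
      have 3: "Neg v \<in> C" if v: "v \<in> atom ` C" "v \<notin> S"
      proof -
        obtain y where "y \<in> C" "v = atom y" using v(1) by blast
        then show ?thesis using v(2) by (cases y) (auto simp: S_def)
      qed
      have "x \<in> Pos ` S \<union> Neg ` (atom ` C - S) \<longleftrightarrow> v \<in> atom ` C \<and> v \<notin> S"
        unfolding Neg by blast
      then show ?thesis using 1 2 3 Neg by blast
    qed
    then have "C = Pos ` S \<union> Neg ` (atom ` C - S)" by (rule set_eqI)
    then have "C = ?h (atom ` C, S)" by (simp only: prod.case)
    moreover have "S \<subseteq> atom ` C"
    proof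
      fix v assume "v \<in> S"
      then show "v \<in> atom ` C" using imageI[of "Pos v" C atom] by (simp add: S_def)
    qed
    moreover have "card (atom ` C) = k" "atom ` C \<subseteq> {..<n}"
      using C by (simp_all add: kclauses_def card_image)
    ultimately have "C = ?h (atom ` C, S)" "(atom ` C, S) \<in> ?A"
      by blast+
    then show "C \<in> ?h ` ?A" by (rule image_eqI)
  qed
  show "?h ` ?A \<subseteq> kclauses k n"
  proof
    fix C assume "C \<in> ?h ` ?A"
    then obtain V S where V: "V \<subseteq> {..<n}" "card V = k" "S \<subseteq> V"
      and Ceq: "C = Pos ` S \<union> Neg ` (V - S)" by auto
    have fin: "finite V" using V(1) finite_subset by blast
    have "atom ` C = S \<union> (V - S)" by (simp add: Ceq image_Un image_image)
    then have im: "atom ` C = V" using V(3) by blast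
    have inj: "inj_on atom C" using V(3) by (auto simp: Ceq inj_on_def)
    have "finite C" using fin finite_subset[OF V(3) fin] by (simp add: Ceq)
    moreover have "card C = k" using card_image[OF inj] im V(2) by simp
    ultimately show "C \<in> kclauses k n"
      using inj im V(1) by (simp add: kclauses_def)
  qed
qed

lemma finite_kclauses [simp]: "finite (kclauses k n)"
proof -
  have "finite {V. V \<subseteq> {..<n} \<and> card V = k}" by simp
  moreover have "finite (Pow V)" if "V \<in> {V. V \<subseteq> {..<n} \<and> card V = k}" for V
    using that finite_subset[of V "{..<n}"] by simp
  ultimately show ?thesis
    unfolding kclauses_eq_image by (intro finite_imageI finite_SigmaI)
qed

lemma card_kclauses: "card (kclauses k n) = 2 ^ k * (n choose k)"
proof -
  let ?B = "{V. V \<subseteq> {..<n} \<and> card V = k}"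
  let ?h = "\<lambda>(V, S). Pos ` S \<union> Neg ` (V - S)"
  have "inj_on ?h (SIGMA V : ?B. Pow V)"
  proof (rule inj_onI, clarsimp)
    fix V S V' S'
    assume *: "S \<subseteq> V" "S' \<subseteq> V'" "Pos ` S \<union> Neg ` (V - S) = Pos ` S' \<union> Neg ` (V' - S')"
    have "v \<in> S \<longleftrightarrow> v \<in> S'" for v
      using arg_cong[OF *(3), of "\<lambda>X. Pos v \<in> X"] by auto
    moreover have "v \<in> V - S \<longleftrightarrow> v \<in> V' - S'" for v
      using arg_cong[OF *(3), of "\<lambda>X. Neg v \<in> X"] by auto
    ultimately show "V = V' \<and> S = S'" using *(1,2) by blast
  qed
  then have "card (kclauses k n) = card (SIGMA V : ?B. Pow V)"
    unfolding kclauses_eq_image by (rule card_image)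
  also have "\<dots> = (\<Sum>V\<in>?B. card (Pow V))"
    by (rule card_SigmaI) (auto intro: finite_subset[of _ "{..<n}"])
  also have "\<dots> = (\<Sum>V\<in>?B. 2 ^ k)"
  proof (rule sum.cong)
    fix V assume "V \<in> ?B"
    then show "card (Pow V) = 2 ^ k" using finite_subset[of V "{..<n}"] by (simp add: card_Pow)
  qed simp
  also have "\<dots> = 2 ^ k * (n choose k)"
    using n_subsets[of "{..<n}" k] by simp
  finally show ?thesis .
qed

end

theory Submission
  imports Defs
begin

text \<open>
  Every variable of a minimal unsatisfiable subformula contributes a literal to the spine, and by
  Hall's theorem an unsatisfiable formula has a subformula with more clauses than variables. When
  \<open>p \<le> n / (n choose k)\<close>, a union bound shows that with high probability no such dense subformula
  lives on fewer than \<open>\<eta> n\<close> variables, so unsatisfiability forces a linear spine. At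
  \<open>p = n / (n choose k)\<close> the expected number of satisfying assignments is at most \<open>(2/e)^n\<close>, and the
  spine only grows with the formula, so larger \<open>p\<close> reduces to this value by monotone coupling.
\<close>

section \<open>Hall's marriage theorem\<close>

theorem hall_marriage:
  fixes A :: "'i \<Rightarrow> 'a set"
  assumes "finite I"
    and "\<And>i. i \<in> I \<Longrightarrow> finite (A i)"
    and "\<And>J. J \<subseteq> I \<Longrightarrow> card J \<le> card (\<Union>(A ` J))"
  shows "\<exists>f. inj_on f I \<and> (\<forall>i\<in>I. f i \<in> A i)"
  using assms
proof (induction "card I" arbitrary: I A rule: less_induct)
  case less
  note fin = less.prems(2) and hall = less.prems(3)
  have finU: "finite (\<Union>(A ` J))" if "J \<subseteq> I" for J
    using that fin less.prems(1) by (auto intro: finite_subset)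
  show ?case
  proof (cases "I = {}")
    case True
    then show ?thesis by simp
  next
    case ne: False
    show ?thesis
    \<comment> \<open>Halmos-Vaughan case distinction. A tight set \<open>J\<close>, with exactly
      \<open>card J\<close> neighbours, splits the problem into two smaller ones. Without tight sets
      every nonempty proper subset has a neighbour to spare, so one index can be matched
      arbitrarily.\<close>
    proof (cases "\<exists>J. J \<subset> I \<and> J \<noteq> {} \<and> card (\<Union>(A ` J)) = card J")
      case True
      then obtain J where J: "J \<subset> I" "J \<noteq> {}" "card (\<Union>(A ` J)) = card J" by blast
      have finJ: "finite J" using J(1) less.prems(1) finite_subset by blast
      have "\<exists>f. inj_on f J \<and> (\<forall>i\<in>J. f i \<in> A i)"
        using J(1) finJ fin hall less.prems(1)
        by (intro less.hyps psubset_card_mono) auto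
      then obtain f where f: "inj_on f J" "\<And>i. i \<in> J \<Longrightarrow> f i \<in> A i" by blast
      \<comment> \<open>Hall's condition survives for \<open>B\<close>: the neighbours of
        \<open>J \<union> K\<close> number at least \<open>card J + card K\<close>, and tightness
        means that exactly \<open>card J\<close> of them are removed.\<close>
      define B where "B = (\<lambda>i. A i - \<Union>(A ` J))"
      have "card (I - J) < card I"
        using J(1,2) less.prems(1) by (intro psubset_card_mono) auto
      then have "\<exists>g. inj_on g (I - J) \<and> (\<forall>i\<in>I - J. g i \<in> B i)"
      proof (rule less.hyps)
        fix K assume K: "K \<subseteq> I - J"
        have finK: "finite K" using K less.prems(1) finite_subset by blast
        have "\<Union>(B ` K) = \<Union>(A ` (J \<union> K)) - \<Union>(A ` J)" by (auto simp: B_def)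
        then have "card (\<Union>(B ` K)) = card (\<Union>(A ` (J \<union> K))) - card J"
          using J(1,3) finU[of J] by (simp add: card_Diff_subset)
        moreover have "card (J \<union> K) = card J + card K"
          using K finK finJ by (intro card_Un_disjoint) auto
        moreover have "card (J \<union> K) \<le> card (\<Union>(A ` (J \<union> K)))"
          using K J(1) by (intro hall) auto
        ultimately show "card K \<le> card (\<Union>(B ` K))" by linarith
      qed (use less.prems(1) fin in \<open>auto simp: B_def\<close>)
      then obtain g where g: "inj_on g (I - J)" "\<And>i. i \<in> I - J \<Longrightarrow> g i \<in> B i" by blast
      define h where "h = (\<lambda>i. if i \<in> J then f i else g i)"
      have "f i \<noteq> g j" if "i \<in> J" "j \<in> I - J" for i j
        using f(2)[OF that(1)] g(2)[OF that(2)] that(1) unfolding B_def by auto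
      then have "inj_on h (J \<union> (I - J))"
        using f(1) g(1) unfolding h_def by (intro inj_on_disjoint_Un) auto
      moreover have "J \<union> (I - J) = I" using J(1) by blast
      ultimately have "inj_on h I" by simp
      moreover have "\<forall>i\<in>I. h i \<in> A i" using f(2) g(2) by (auto simp: h_def B_def)
      ultimately show ?thesis by blast
    next
      case False
      have strict: "card J < card (\<Union>(A ` J))" if "J \<subset> I" "J \<noteq> {}" for J
      proof -
        have "card (\<Union>(A ` J)) \<noteq> card J" using False that by blast
        moreover have "card J \<le> card (\<Union>(A ` J))" using that by (intro hall) auto
        ultimately show ?thesis by simp
      qed
      obtain i where i: "i \<in> I" using ne by blast
      have "card {i} \<le> card (A i)" using hall[of "{i}"] i by simp
      then have "A i \<noteq> {}" by auto
      then obtain x where x: "x \<in> A i" by blast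
      \<comment> \<open>Removing \<open>x\<close> costs each set of indices at most one neighbour,
        which \<open>strict\<close> absorbs.\<close>
      define B where "B = (\<lambda>j. A j - {x})"
      have "card (I - {i}) < card I"
        using i less.prems(1) by (intro psubset_card_mono) auto
      then have "\<exists>g. inj_on g (I - {i}) \<and> (\<forall>j\<in>I - {i}. g j \<in> B j)"
      proof (rule less.hyps)
        fix K assume K: "K \<subseteq> I - {i}"
        show "card K \<le> card (\<Union>(B ` K))"
        proof (cases "K = {}")
          case False
          have "\<Union>(B ` K) = \<Union>(A ` K) - {x}" by (auto simp: B_def)
          moreover have "card K < card (\<Union>(A ` K))" using K i False by (intro strict) auto
          ultimately show ?thesis by (auto simp: card_Diff_singleton_if)
        qed simp
      qed (use less.prems(1) fin in \<open>auto simp: B_def\<close>)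
      then obtain g where g: "inj_on g (I - {i})" "\<And>j. j \<in> I - {i} \<Longrightarrow> g j \<in> B j" by blast
      have gx: "g j \<noteq> x" if "j \<in> I" "j \<noteq> i" for j
        using g(2)[of j] that by (auto simp: B_def)
      have "x \<notin> g ` (I - {i})" using gx by blast
      then have "inj_on (g(i := x)) (insert i (I - {i}))"
        unfolding inj_on_insert using inj_on_fun_updI[OF g(1)] by auto
      then have "inj_on (g(i := x)) I" using i by (simp add: insert_absorb)
      moreover have "\<forall>j\<in>I. (g(i := x)) j \<in> A j" using g(2) x by (auto simp: B_def)
      ultimately show ?thesis by blast
    qed
  qed
qed

section \<open>Dense subformulas and the spine of an unsatisfiable formula\<close>

lemma compl_compl [simp]: "compl (compl l) = l"
  by (cases l) auto

lemma atom_compl [simp]: "atom (compl l) = atom l"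
  by (cases l) auto

lemma spine_mono: "\<Phi> \<subseteq> \<Psi> \<Longrightarrow> spine \<Phi> \<subseteq> spine \<Psi>"
  unfolding spine_def by blast

text \<open>If no subformula had more clauses than variables, Hall's theorem would give each clause
  a private variable, and these variables could be set to satisfy their clauses independently of
  each other.\<close>

lemma unsat_imp_dense:
  assumes "finite \<Xi>" "\<And>C. C \<in> \<Xi> \<Longrightarrow> finite C" "\<Xi> \<notin> SAT"
  shows "\<exists>F\<subseteq>\<Xi>. card (atom ` \<Union>F) < card F"
proof (rule ccontr)
  assume "\<not> ?thesis"
  then have "card F \<le> card (\<Union>((`) atom ` F))" if "F \<subseteq> \<Xi>" for F
    using that by (auto simp: not_less image_Union)
  then have "\<exists>f. inj_on f \<Xi> \<and> (\<forall>C\<in>\<Xi>. f C \<in> atom ` C)"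
    using assms by (intro hall_marriage) auto
  then obtain f where f: "inj_on f \<Xi>" "\<forall>C\<in>\<Xi>. \<exists>l\<in>C. atom l = f C" by fastforce
  from bchoice[of \<Xi> "\<lambda>C l. l \<in> C \<and> atom l = f C"] f(2)
  obtain l where l: "\<And>C. C \<in> \<Xi> \<Longrightarrow> l C \<in> C \<and> atom (l C) = f C" by auto
  \<comment> \<open>A matched variable follows the sign of the literal chosen in its clause; all
    others are false. Injectivity of \<open>f\<close> prevents a negative chosen literal from
    clashing with a positive one of another clause.\<close>
  define \<sigma> where "\<sigma> = (\<lambda>v. \<exists>C\<in>\<Xi>. l C = Pos v)"
  have "lit_true \<sigma> (l C)" if C: "C \<in> \<Xi>" for C
  proof (cases "l C")
    case (Pos v)
    then show ?thesis using C by (auto simp: \<sigma>_def)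
  next
    case (Neg v)
    have False if D: "D \<in> \<Xi>" "l D = Pos v" for D
    proof -
      have "f C = f D" using l[OF C] l[OF D(1)] D(2) Neg by auto
      then have "C = D" using f(1) C D(1) by (auto dest: inj_onD)
      then show False using D(2) Neg by simp
    qed
    then show ?thesis using Neg by (auto simp: \<sigma>_def)
  qed
  then have "models \<sigma> \<Xi>" using l unfolding models_def by blast
  with assms(3) show False by (auto simp: SAT_def)
qed

lemma unsat_imp_minimal:
  assumes "finite \<Phi>" "\<Phi> \<notin> SAT"
  shows "\<exists>\<Xi>\<subseteq>\<Phi>. \<Xi> \<notin> SAT \<and> (\<forall>C\<in>\<Xi>. \<Xi> - {C} \<in> SAT)"
proof -
  obtain \<Xi> where X: "\<Xi> \<subseteq> \<Phi>" "\<Xi> \<notin> SAT"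
    and min: "\<And>\<Psi>. \<Psi> \<subseteq> \<Phi> \<Longrightarrow> \<Psi> \<notin> SAT \<Longrightarrow> card \<Xi> \<le> card \<Psi>"
    using ex_has_least_nat[of "\<lambda>\<Psi>. \<Psi> \<subseteq> \<Phi> \<and> \<Psi> \<notin> SAT" \<Phi> card] assms(2) by blast
  have "\<Xi> - {C} \<in> SAT" if "C \<in> \<Xi>" for C
  proof (rule ccontr)
    assume "\<Xi> - {C} \<notin> SAT"
    then have "card \<Xi> \<le> card (\<Xi> - {C})" using X(1) by (intro min) auto
    moreover have "card (\<Xi> - {C}) < card \<Xi>"
      using that X(1) assms(1) finite_subset by (intro psubset_card_mono) blast+
    ultimately show False by simp
  qed
  with X show ?thesis by blast
qed

text \<open>The witness is \<open>\<Xi> - {C}\<close>: an assignment satisfying it together with the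
  unit clause of \<open>l\<close> would also satisfy \<open>C\<close>, hence all of
  \<open>\<Xi>\<close>.\<close>

lemma compl_in_spine:
  assumes "\<Xi> \<subseteq> \<Phi>" "\<Xi> \<notin> SAT" "\<Xi> - {C} \<in> SAT" "C \<in> \<Xi>" "l \<in> C"
  shows "compl l \<in> spine \<Phi>"
proof -
  have "insert {l} (\<Xi> - {C}) \<notin> SAT"
  proof
    assume "insert {l} (\<Xi> - {C}) \<in> SAT"
    then obtain \<sigma> where "models \<sigma> (insert {l} (\<Xi> - {C}))" by (auto simp: SAT_def)
    then have "models \<sigma> \<Xi>" using assms(5) unfolding models_def by blast
    with assms(2) show False by (auto simp: SAT_def)
  qed
  moreover have "\<Xi> - {C} \<subseteq> \<Phi>" using assms(1) by blast
  ultimately show ?thesis using assms(3) unfolding spine_def by auto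
qed

lemma finite_spine: "finite \<Phi> \<Longrightarrow> (\<And>C. C \<in> \<Phi> \<Longrightarrow> finite C) \<Longrightarrow> finite (spine \<Phi>)"
  by (rule finite_subset[OF spine_subset_Union]) auto

text \<open>The dense family is found inside a minimal unsatisfiable subformula. There the
  complement of every occurring literal lies in the spine, so each variable of the family underlies
  some spine literal.\<close>

lemma unsat_imp_dense_in_spine:
  assumes fin: "finite \<Phi>" "\<And>C. C \<in> \<Phi> \<Longrightarrow> finite C" and "\<Phi> \<notin> SAT"
  shows "\<exists>F\<subseteq>\<Phi>. card (atom ` \<Union>F) < card F \<and> card (atom ` \<Union>F) \<le> card (spine \<Phi>)"
proof -
  obtain \<Xi> where X: "\<Xi> \<subseteq> \<Phi>" "\<Xi> \<notin> SAT" "\<forall>C\<in>\<Xi>. \<Xi> - {C} \<in> SAT"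
    using unsat_imp_minimal assms by blast
  have "\<exists>F\<subseteq>\<Xi>. card (atom ` \<Union>F) < card F"
    using X(1) fin finite_subset[OF X(1)] by (intro unsat_imp_dense[OF _ _ X(2)]) auto
  then obtain F where F: "F \<subseteq> \<Xi>" "card (atom ` \<Union>F) < card F" by blast
  have "atom ` \<Union>F \<subseteq> atom ` spine \<Phi>"
  proof
    fix v assume "v \<in> atom ` \<Union>F"
    then obtain C l where "C \<in> F" "l \<in> C" "v = atom l" by blast
    then have "compl l \<in> spine \<Phi>" "v = atom (compl l)"
      using X F(1) by (auto intro!: compl_in_spine[of \<Xi> \<Phi> C])
    then show "v \<in> atom ` spine \<Phi>" by blast
  qed
  then have "card (atom ` \<Union>F) \<le> card (atom ` spine \<Phi>)"
    using fin by (intro card_mono finite_imageI finite_spine)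
  also have "\<dots> \<le> card (spine \<Phi>)"
    using fin by (intro card_image_le finite_spine)
  finally show ?thesis using F X(1) by blast
qed

section \<open>Event probabilities and monotonicity for random formulas\<close>

lemma set_pmf_random_ksat: "set_pmf (random_ksat k n p) \<subseteq> Pow (kclauses k n)"
  by (auto simp: random_ksat_def)

lemma prob_superset_random_ksat:
  assumes "0 \<le> p" "p \<le> 1" "F \<subseteq> kclauses k n"
  shows "measure_pmf.prob (random_ksat k n p) {\<Phi>. F \<subseteq> \<Phi>} = p ^ card F"
proof -
  let ?B = "\<lambda>C. if C \<in> F then {True} else UNIV"
  have "(\<lambda>f. {C \<in> kclauses k n. f C}) -` {\<Phi>. F \<subseteq> \<Phi>} = Pi (kclauses k n) ?B"
    using assms(3) by (auto simp: Pi_def split: if_splits)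
  then have "measure_pmf.prob (random_ksat k n p) {\<Phi>. F \<subseteq> \<Phi>} =
      (\<Prod>C\<in>kclauses k n. measure_pmf.prob (bernoulli_pmf p) (?B C))"
    unfolding random_ksat_def measure_map_pmf by (simp only: measure_Pi_pmf_Pi[OF finite_kclauses])
  also have "\<dots> = (\<Prod>C\<in>kclauses k n. if C \<in> F then p else 1)"
    using assms by (intro prod.cong) (auto simp: measure_pmf_single)
  also have "\<dots> = p ^ card F"
    using assms(3) by (simp add: prod.If_cases Int_absorb1)
  finally show ?thesis .
qed

lemma prob_disjoint_random_ksat:
  assumes "0 \<le> p" "p \<le> 1" "D \<subseteq> kclauses k n"
  shows "measure_pmf.prob (random_ksat k n p) {\<Phi>. D \<inter> \<Phi> = {}} = (1 - p) ^ card D"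
proof -
  let ?B = "\<lambda>C. if C \<in> D then {False} else UNIV"
  have "(\<lambda>f. {C \<in> kclauses k n. f C}) -` {\<Phi>. D \<inter> \<Phi> = {}} = Pi (kclauses k n) ?B"
    using assms(3) by (auto simp: Pi_def split: if_splits)
  then have "measure_pmf.prob (random_ksat k n p) {\<Phi>. D \<inter> \<Phi> = {}} =
      (\<Prod>C\<in>kclauses k n. measure_pmf.prob (bernoulli_pmf p) (?B C))"
    unfolding random_ksat_def measure_map_pmf by (simp only: measure_Pi_pmf_Pi[OF finite_kclauses])
  also have "\<dots> = (\<Prod>C\<in>kclauses k n. if C \<in> D then 1 - p else 1)"
    using assms by (intro prod.cong) (auto simp: measure_pmf_single)
  also have "\<dots> = (1 - p) ^ card D"
    using assms(3) by (simp add: prod.If_cases Int_absorb1)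
  finally show ?thesis .
qed

text \<open>Coupling: keep a clause in the denser formula with probability \<open>q\<close>, and
  retain it in the sparser one by a further independent coin of bias \<open>p / q\<close>. The
  sparser formula is then always a subset of the denser one.\<close>

lemma prob_random_ksat_mono:
  assumes pq: "0 \<le> p" "p \<le> q" "q \<le> 1"
    and up: "\<And>\<Phi> \<Psi>. \<Phi> \<subseteq> \<Psi> \<Longrightarrow> \<Psi> \<subseteq> kclauses k n \<Longrightarrow> \<Phi> \<in> U \<Longrightarrow> \<Psi> \<in> U"
  shows "measure_pmf.prob (random_ksat k n p) U \<le> measure_pmf.prob (random_ksat k n q) U"
proof -
  \<comment> \<open>For \<open>q = 0\<close> also \<open>p = 0\<close>, and division by zero yields
    \<open>t = 0\<close>, so \<open>q * t = p\<close> still holds.\<close>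
  define t where "t = p / q"
  have t: "0 \<le> t" "t \<le> 1" "q * t = p" using pq by (auto simp: t_def divide_le_eq_1)
  define r where "r = bind_pmf (bernoulli_pmf q) (\<lambda>a.
    bind_pmf (bernoulli_pmf t) (\<lambda>b. return_pmf (a, a \<and> b)))"
  \<comment> \<open>Both projections send the default pair to \<open>False\<close>, the default
    value in \<open>random_ksat\<close>.\<close>
  define R where "R = Pi_pmf (kclauses k n) (False, False) (\<lambda>_. r)"
  have r1: "map_pmf fst r = bernoulli_pmf q"
    by (simp add: r_def map_bind_pmf bind_pmf_const bind_return_pmf')
  have r2: "map_pmf snd r = bernoulli_pmf p"
  proof (rule pmf_eqI)
    fix b
    have "pmf (map_pmf snd r) True = p"
      using t pq by (simp add: r_def map_bind_pmf pmf_bind measure_pmf_single)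
    then show "pmf (map_pmf snd r) b = pmf (bernoulli_pmf p) b"
      using pq pmf_False_conv_True[of "map_pmf snd r"] by (cases b) auto
  qed
  have q: "random_ksat k n q = map_pmf (\<lambda>h. {C \<in> kclauses k n. fst (h C)}) R"
    unfolding random_ksat_def R_def r1[symmetric]
    by (subst Pi_pmf_map[where dflt = "(False, False)"]) (auto simp: map_pmf_comp)
  have p: "random_ksat k n p = map_pmf (\<lambda>h. {C \<in> kclauses k n. snd (h C)}) R"
    unfolding random_ksat_def R_def r2[symmetric]
    by (subst Pi_pmf_map[where dflt = "(False, False)"]) (auto simp: map_pmf_comp)
  have r_imp: "snd x \<longrightarrow> fst x" if "x \<in> set_pmf r" for x
    using that by (auto simp: r_def)
  have "{C \<in> kclauses k n. fst (h C)} \<in> U"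
    if "h \<in> set_pmf R" "{C \<in> kclauses k n. snd (h C)} \<in> U" for h
  proof (rule up[OF _ _ that(2)])
    have "h C \<in> set_pmf r" if "C \<in> kclauses k n" for C
      using set_Pi_pmf_subset'[OF finite_kclauses, of k n] \<open>h \<in> set_pmf R\<close> that
      unfolding R_def PiE_dflt_def by fastforce
    then show "{C \<in> kclauses k n. snd (h C)} \<subseteq> {C \<in> kclauses k n. fst (h C)}"
      using r_imp by blast
  qed auto
  then show ?thesis
    unfolding p q measure_map_pmf
    by (intro measure_pmf.finite_measure_mono_AE) (auto simp: AE_measure_pmf_iff)
qed

text \<open>First moment bound: an assignment falsifies exactly one clause on each set of
  \<open>k\<close> variables, and it is a model only if none of these \<open>n choose k\<close>
  clauses is present. The factor \<open>2 ^ n\<close> counts the assignments.\<close>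

lemma prob_SAT_le:
  assumes "0 \<le> p" "p \<le> 1"
  shows "measure_pmf.prob (random_ksat k n p) SAT \<le> 2 ^ n * (1 - p) ^ (n choose k)"
proof -
  let ?P = "measure_pmf.prob (random_ksat k n p)"
  \<comment> \<open>An assignment is coded by its set \<open>S\<close> of true variables.
    \<open>lit S v\<close> is the literal of \<open>v\<close> that it falsifies, and
    \<open>D S\<close> the family of clauses that it falsifies.\<close>
  define lit where "lit = (\<lambda>S v. if v \<in> S then Neg v else Pos v)"
  define D where "D = (\<lambda>S. (`) (lit S) ` {V. V \<subseteq> {..<n} \<and> card V = k})"
  have at: "atom (lit S v) = v" for S v by (simp add: lit_def)
  have imD: "atom ` lit S ` V = V" for S V by (simp add: image_image at)
  have injD: "inj_on ((`) (lit S)) X" for S X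
    by (rule inj_on_inverseI[where g = "(`) atom"]) (rule imD)
  have cardD: "card (D S) = n choose k" for S
    unfolding D_def by (simp add: card_image[OF injD] n_subsets)
  have subD: "D S \<subseteq> kclauses k n" for S
  proof
    fix C assume "C \<in> D S"
    then obtain V where V: "V \<subseteq> {..<n}" "card V = k" "C = lit S ` V" by (auto simp: D_def)
    have "inj_on (lit S) V" "inj_on atom (lit S ` V)"
      by (auto intro!: inj_onI) (metis at)+
    then show "C \<in> kclauses k n"
      using V finite_subset[OF V(1)] by (simp add: kclauses_def card_image imD)
  qed
  have "SAT \<inter> Pow (kclauses k n) \<subseteq> (\<Union>S\<in>Pow {..<n}. {\<Phi>. D S \<inter> \<Phi> = {}})"
  proof
    fix \<Phi> assume "\<Phi> \<in> SAT \<inter> Pow (kclauses k n)"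
    then obtain \<sigma> where \<sigma>: "models \<sigma> \<Phi>" by (auto simp: SAT_def)
    define S where "S = {v \<in> {..<n}. \<sigma> v}"
    have "D S \<inter> \<Phi> = {}"
    proof (rule ccontr)
      assume "D S \<inter> \<Phi> \<noteq> {}"
      then obtain V where "V \<subseteq> {..<n}" "lit S ` V \<in> \<Phi>" by (auto simp: D_def)
      then obtain v where "v < n" "lit_true \<sigma> (lit S v)"
        using \<sigma> unfolding models_def by blast
      then show False by (auto simp: lit_def S_def split: if_splits)
    qed
    then show "\<Phi> \<in> (\<Union>S\<in>Pow {..<n}. {\<Phi>. D S \<inter> \<Phi> = {}})" by (auto simp: S_def)
  qed
  then have "?P SAT \<le> ?P (\<Union>S\<in>Pow {..<n}. {\<Phi>. D S \<inter> \<Phi> = {}})"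
    using set_pmf_random_ksat[of k n p]
    by (intro measure_pmf.finite_measure_mono_AE) (fastforce simp: AE_measure_pmf_iff)+
  also have "\<dots> \<le> (\<Sum>S\<in>Pow {..<n}. ?P {\<Phi>. D S \<inter> \<Phi> = {}})"
    by (rule measure_pmf.finite_measure_subadditive_finite) auto
  also have "\<dots> = 2 ^ n * (1 - p) ^ (n choose k)"
    by (simp add: prob_disjoint_random_ksat[OF assms subD] cardD card_Pow)
  finally show ?thesis .
qed

section \<open>Binomial estimates and the union bound over dense subformulas\<close>

lemma binomial_le_exp_power:
  assumes "s > 0"
  shows "real (m choose s) \<le> (exp 1 * real m / real s) ^ s"
proof -
  \<comment> \<open>A single term of the exponential series. It bounds \<open>fact s\<close> from
    below by (s/e)^s.\<close>
  have "real s ^ s / fact s \<le> exp (real s)"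
  proof -
    have "(\<Sum>i\<in>{s}. real s ^ i /\<^sub>R fact i) \<le> (\<Sum>i. real s ^ i /\<^sub>R fact i)"
      by (intro sum_le_suminf summable_exp_generic) auto
    then show ?thesis by (simp add: exp_def divide_inverse mult.commute)
  qed
  then have "real s ^ s \<le> exp 1 ^ s * fact s"
    by (simp add: field_simps flip: exp_of_nat_mult)
  moreover have "real (m choose s) * fact s \<le> real m ^ s"
    using binomial_fact_pow[of m s, THEN of_nat_mono[where 'a = real]] by simp
  ultimately have "(real s ^ s * real (m choose s)) * fact s \<le> (exp 1 ^ s * real m ^ s) * fact s"
    by (smt (verit) mult.assoc mult.commute mult_mono fact_ge_zero of_nat_0_le_iff zero_le_power exp_ge_zero)
  then have "real s ^ s * real (m choose s) \<le> exp 1 ^ s * real m ^ s"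
    by (rule mult_right_le_imp_le) simp
  then show ?thesis using assms by (simp add: power_mult_distrib power_divide field_simps)
qed

text \<open>The ratio is the product of the fractions (m - i)/(n - i) for i < k, each at most m/n
  because \<open>m \<le> n\<close>; for \<open>m < k\<close> the left side vanishes.\<close>

lemma binomial_ratio_le:
  assumes "k \<le> n" "m \<le> n"
  shows "real (m choose k) / real (n choose k) \<le> (real m / real n) ^ k"
proof (cases "k \<le> m")
  case False
  then show ?thesis by (simp add: binomial_eq_0)
next
  case True
  have "real (m choose k) / real (n choose k) =
      (\<Prod>i = 0..<k. (real (m - i) / real (k - i)) / (real (n - i) / real (k - i)))"
    using True assms by (simp add: binomial_altdef_of_nat prod_dividef)
  also have "\<dots> \<le> (\<Prod>i = 0..<k. real m / real n)"
  proof (intro prod_mono conjI)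
    fix i assume i: "i \<in> {0..<k}"
    have "real i * real m \<le> real i * real n" using assms by (intro mult_left_mono) auto
    then have "real (m - i) / real (n - i) \<le> real m / real n"
      using i True assms by (simp add: of_nat_diff field_simps)
    then show "real (m - i) / real (k - i) / (real (n - i) / real (k - i)) \<le> real m / real n"
      using i by simp
  qed auto
  also have "\<dots> = (real m / real n) ^ k" by simp
  finally show ?thesis .
qed

text \<open>Positivity excludes the degenerate family consisting of the empty clause alone, and lets
  the union bound start at one variable.\<close>

definition dense_upto :: "nat \<Rightarrow> cnf set" where
  "dense_upto m = {\<Phi>. \<exists>F\<subseteq>\<Phi>. card (atom ` \<Union>F) < card F \<and>
     0 < card (atom ` \<Union>F) \<and> card (atom ` \<Union>F) \<le> m}"

text \<open>A deliberate overcount: all \<open>k\<close>-sets of the \<open>2 * card V\<close>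
  literals over \<open>V\<close>, including those with complementary literals. A single binomial
  coefficient suits \<open>binomial_ratio_le\<close>.\<close>

lemma card_kclauses_within_le:
  assumes "finite V"
  shows "card {C \<in> kclauses k n. atom ` C \<subseteq> V} \<le> (2 * card V) choose k"
proof -
  let ?L = "Pos ` V \<union> Neg ` V"
  have "l \<in> ?L" if "atom l \<in> V" for l
    using that by (cases l) auto
  then have "C \<subseteq> ?L" if "atom ` C \<subseteq> V" for C
    using that by blast
  then have "{C \<in> kclauses k n. atom ` C \<subseteq> V} \<subseteq> {C. C \<subseteq> ?L \<and> card C = k}"
    unfolding kclauses_def by blast
  then have "card {C \<in> kclauses k n. atom ` C \<subseteq> V} \<le> card {C. C \<subseteq> ?L \<and> card C = k}"
    using assms by (intro card_mono) auto
  also have "\<dots> = card ?L choose k"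
    using assms by (intro n_subsets) auto
  also have "card ?L = 2 * card V"
    using assms by (subst card_Un_disjoint) (auto simp: card_image inj_on_def)
  finally show ?thesis .
qed

text \<open>The left side is the expected number of pairs of a set of \<open>s\<close> variables and
  \<open>s\<close> clauses of the random formula on those variables.\<close>

lemma expected_dense_at_le:
  assumes p: "0 \<le> p" "p \<le> 1" "p \<le> real n / real (n choose k)"
    and k: "3 \<le> k" "k \<le> n" and s: "0 < s" "2 * s \<le> n"
  shows "(\<Sum>V | V \<subseteq> {..<n} \<and> card V = s.
      \<Sum>F | F \<subseteq> {C \<in> kclauses k n. atom ` C \<subseteq> V} \<and> card F = s. p ^ s)
    \<le> (exp 2 * 2 ^ k * (real s / real n)) ^ s"
proof -
  let ?K = "\<lambda>V. {C \<in> kclauses k n. atom ` C \<subseteq> V}"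
  let ?e = "exp (1::real)"
  define N where "N = (2 * s) choose k"
  have "(\<Sum>V | V \<subseteq> {..<n} \<and> card V = s. \<Sum>F | F \<subseteq> ?K V \<and> card F = s. p ^ s)
      \<le> (\<Sum>V | V \<subseteq> {..<n} \<and> card V = s. real (N choose s) * p ^ s)"
  proof (rule sum_mono)
    fix V assume "V \<in> {V. V \<subseteq> {..<n} \<and> card V = s}"
    then have V: "finite V" "card V = s" using finite_subset by auto
    have "card {F. F \<subseteq> ?K V \<and> card F = s} = card (?K V) choose s"
      by (intro n_subsets) auto
    also have "\<dots> \<le> N choose s"
      unfolding N_def using card_kclauses_within_le[OF V(1), of k n] V(2)
      by (intro binomial_right_mono) simp
    finally show "(\<Sum>F | F \<subseteq> ?K V \<and> card F = s. p ^ s) \<le> real (N choose s) * p ^ s"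
      using p(1) by (simp add: mult_right_mono)
  qed
  also have "\<dots> = real (n choose s) * (real (N choose s) * p ^ s)"
    by (simp add: n_subsets)
  also have "\<dots> \<le> (?e * real n / real s) ^ s * ((?e * real N / real s) ^ s * p ^ s)"
    using s(1) p(1) by (intro mult_mono binomial_le_exp_power) auto
  also have "\<dots> = (?e * real n / real s * (?e * real N / real s * p)) ^ s"
    by (simp only: power_mult_distrib)
  \<comment> \<open>Both sides are \<open>s\<close>-th powers, so comparing the bases
    suffices.\<close>
  also have "\<dots> \<le> (exp 2 * 2 ^ k * (real s / real n)) ^ s"
  proof (rule power_mono)
    have sn: "0 < real s" "0 < real n" using s by auto
    have "real N * p \<le> real N * (real n / real (n choose k))"
      using p(3) by (intro mult_left_mono) auto
    also have "\<dots> = real n * (real N / real (n choose k))" by simp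
    also have "\<dots> \<le> real n * (real (2 * s) / real n) ^ k"
      unfolding N_def using k s by (intro mult_left_mono binomial_ratio_le) auto
    also have "\<dots> = real n * 2 ^ k * (real s / real n) ^ k"
      by (simp add: power_mult_distrib power_divide)
    \<comment> \<open>Here \<open>3 \<le> k\<close> enters: two factors \<open>s / n\<close> cancel
      against the choices of variables and clauses, and one remains to make the bound small.\<close>
    also have "\<dots> \<le> real n * 2 ^ k * (real s / real n) ^ 3"
      using k s sn by (intro mult_left_mono power_decreasing) auto
    finally have Np: "real N * p \<le> real n * 2 ^ k * (real s / real n) ^ 3" .
    have e2: "exp 2 = ?e * ?e" by (simp flip: exp_add)
    have "?e * real n / real s * (?e * real N / real s * p) =
        exp 2 * real n / (real s)\<^sup>2 * (real N * p)"
      by (simp add: e2 power2_eq_square)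
    also have "\<dots> \<le> exp 2 * real n / (real s)\<^sup>2 * (real n * 2 ^ k * (real s / real n) ^ 3)"
      by (intro mult_left_mono Np) auto
    also have "\<dots> = exp 2 * 2 ^ k * (real s / real n)"
      using sn by (simp add: field_simps power2_eq_square power3_eq_cube)
    finally show "?e * real n / real s * (?e * real N / real s * p) \<le>
      exp 2 * 2 ^ k * (real s / real n)" .
  qed (use p in auto)
  finally show ?thesis .
qed

text \<open>With s = j + 1 the base is at most 1/4. Bounding \<open>j\<close> of the factors by 1/4
  and j + 1 by 2^j in the remaining one leaves (A/n)(1/2)^j, a geometric series that keeps the
  factor 1/n.\<close>

lemma sum_power_self_le:
  fixes A :: real
  assumes "0 \<le> A" "0 < n" "4 * A * real m \<le> real n"
  shows "(\<Sum>s = 1..m. (A * (real s / real n)) ^ s) \<le> 2 * A / real n"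
proof -
  have "(A * (real (Suc j) / real n)) ^ Suc j \<le> A / real n * (1 / 2) ^ j" if j: "j < m" for j
  proof -
    have "4 * A * real (Suc j) \<le> 4 * A * real m"
      using j assms(1) by (intro mult_left_mono) auto
    then have "4 * A * real (Suc j) \<le> real n" using assms(3) by linarith
    then have q: "A * (real (Suc j) / real n) \<le> 1 / 4"
      using assms(2) by (simp add: field_simps)
    have "Suc j \<le> 2 ^ j" using less_exp[of j] by (simp add: Suc_le_eq)
    then have j2: "real (Suc j) \<le> 2 ^ j" by (metis of_nat_le_iff of_nat_numeral of_nat_power)
    have "(A * (real (Suc j) / real n)) ^ Suc j \<le> A * (real (Suc j) / real n) * (1 / 4) ^ j"
      unfolding power_Suc using q assms(1) by (intro mult_left_mono power_mono) auto
    also have "\<dots> \<le> A * (2 ^ j / real n) * (1 / 4) ^ j"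
      using j2 assms(1) by (intro mult_right_mono mult_left_mono divide_right_mono) auto
    also have "\<dots> = A / real n * (2 * (1 / 4)) ^ j"
      by (simp only: power_mult_distrib) simp
    finally show ?thesis by simp
  qed
  then have "(\<Sum>j<m. (A * (real (Suc j) / real n)) ^ Suc j) \<le> (\<Sum>j<m. A / real n * (1 / 2) ^ j)"
    by (intro sum_mono) auto
  also have "\<dots> = A / real n * (\<Sum>j<m. (1 / 2) ^ j)"
    by (simp only: sum_distrib_left)
  also have "\<dots> \<le> A / real n * 2"
  proof (rule mult_left_mono)
    show "(\<Sum>j<m. (1 / 2) ^ j) \<le> (2::real)"
      by (subst geometric_sum) (simp_all add: field_simps)
  qed (use assms in auto)
  finally show ?thesis
    using sum.shift_bounds_Suc_ivl[of "\<lambda>s. (A * (real s / real n)) ^ s" 0 m]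
    by (simp add: atLeastLessThanSuc_atLeastAtMost atLeast0LessThan mult.commute)
qed

lemma prob_dense_upto_le:
  assumes p: "0 \<le> p" "p \<le> 1" "p \<le> real n / real (n choose k)"
    and k: "3 \<le> k" "k \<le> n" and m: "4 * (exp 2 * 2 ^ k) * real m \<le> real n"
  shows "measure_pmf.prob (random_ksat k n p) (dense_upto m) \<le> 2 * (exp 2 * 2 ^ k) / real n"
proof -
  let ?K = "\<lambda>V. {C \<in> kclauses k n. atom ` C \<subseteq> V}"
  let ?P = "measure_pmf.prob (random_ksat k n p)"
  let ?V = "\<lambda>s. {V. V \<subseteq> {..<n} \<and> card V = s}"
  let ?F = "\<lambda>s V. {F. F \<subseteq> ?K V \<and> card F = s}"
  have finV: "finite (?V s)" for s by simp
  have finF: "finite (?F s V)" for s V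
    by (rule finite_subset[of _ "Pow (kclauses k n)"]) auto
  \<comment> \<open>This yields \<open>2 * m \<le> n\<close>, as \<open>expected_dense_at_le\<close>
    requires for every \<open>s\<close> up to \<open>m\<close>.\<close>
  have "2 * real m \<le> 4 * (exp 2 * 2 ^ k) * real m"
  proof (rule mult_right_mono)
    have "1 * 1 \<le> exp 2 * (2::real) ^ k" by (intro mult_mono) auto
    then show "2 \<le> 4 * (exp 2 * (2::real) ^ k)" by simp
  qed simp
  then have m2: "2 * m \<le> n" using m by linarith
  have "dense_upto m \<inter> Pow (kclauses k n) \<subseteq>
      (\<Union>s\<in>{1..m}. \<Union>V\<in>?V s. \<Union>F\<in>?F s V. {\<Phi>. F \<subseteq> \<Phi>})"
  proof
    fix \<Phi> assume \<Phi>: "\<Phi> \<in> dense_upto m \<inter> Pow (kclauses k n)"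
    then obtain F where F: "F \<subseteq> \<Phi>" "card (atom ` \<Union>F) < card F"
      "0 < card (atom ` \<Union>F)" "card (atom ` \<Union>F) \<le> m"
      by (auto simp: dense_upto_def)
    define V where "V = atom ` \<Union>F"
    \<comment> \<open>As many clauses as variables already suffice for the estimate, so the surplus
      is discarded and the union runs over families of exactly \<open>card V\<close>
      clauses.\<close>
    have "card V \<le> card F" using F(2) by (simp add: V_def)
    then obtain G where G: "G \<subseteq> F" "card G = card V"
      by (rule obtain_subset_with_card_n)
    have "V \<subseteq> {..<n}" using \<Phi> F(1) by (fastforce simp: V_def kclauses_def)
    moreover have "G \<subseteq> ?K V" using G(1) F(1) \<Phi> by (auto simp: V_def)
    moreover have "G \<subseteq> \<Phi>" using G(1) F(1) by blast
    moreover have "card V \<in> {1..m}" using F by (simp add: V_def)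
    ultimately show "\<Phi> \<in> (\<Union>s\<in>{1..m}. \<Union>V\<in>?V s. \<Union>F\<in>?F s V. {\<Phi>. F \<subseteq> \<Phi>})"
      using G(2) by blast
  qed
  then have "?P (dense_upto m) \<le> ?P (\<Union>s\<in>{1..m}. \<Union>V\<in>?V s. \<Union>F\<in>?F s V. {\<Phi>. F \<subseteq> \<Phi>})"
    using set_pmf_random_ksat[of k n p]
    by (intro measure_pmf.finite_measure_mono_AE AE_pmfI) (blast, simp)
  also have "\<dots> \<le> (\<Sum>s = 1..m. ?P (\<Union>V\<in>?V s. \<Union>F\<in>?F s V. {\<Phi>. F \<subseteq> \<Phi>}))"
    by (rule measure_pmf.finite_measure_subadditive_finite) auto
  also have "\<dots> \<le> (\<Sum>s = 1..m. \<Sum>V\<in>?V s. ?P (\<Union>F\<in>?F s V. {\<Phi>. F \<subseteq> \<Phi>}))"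
    using finV by (intro sum_mono measure_pmf.finite_measure_subadditive_finite) auto
  also have "\<dots> \<le> (\<Sum>s = 1..m. \<Sum>V\<in>?V s. \<Sum>F\<in>?F s V. ?P {\<Phi>. F \<subseteq> \<Phi>})"
    by (intro sum_mono measure_pmf.finite_measure_subadditive_finite finF) auto
  also have "\<dots> = (\<Sum>s = 1..m. \<Sum>V\<in>?V s. \<Sum>F\<in>?F s V. p ^ s)"
  proof (intro sum.cong refl)
    fix s V F assume "F \<in> ?F s V"
    then have "F \<subseteq> kclauses k n" "card F = s" by auto
    then show "?P {\<Phi>. F \<subseteq> \<Phi>} = p ^ s"
      using prob_superset_random_ksat[OF p(1,2)] by simp
  qed
  also have "\<dots> \<le> (\<Sum>s = 1..m. (exp 2 * 2 ^ k * (real s / real n)) ^ s)"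
    using m2 by (intro sum_mono expected_dense_at_le[OF p k]) auto
  also have "\<dots> \<le> 2 * (exp 2 * 2 ^ k) / real n"
    using m k by (intro sum_power_self_le) auto
  finally show ?thesis .
qed

section \<open>Linear spine with high probability\<close>

lemma unsat_spine_large:
  assumes \<Phi>: "\<Phi> \<subseteq> kclauses k n" and "0 < k"
    and unsat: "\<Phi> \<notin> SAT" and sparse: "\<Phi> \<notin> dense_upto m"
  shows "m < card (spine \<Phi>)"
proof -
  have fin: "finite \<Phi>" "\<And>C. C \<in> \<Phi> \<Longrightarrow> finite C"
    using \<Phi> finite_subset[OF \<Phi> finite_kclauses] by (auto simp: kclauses_def)
  obtain F where F: "F \<subseteq> \<Phi>" "card (atom ` \<Union>F) < card F" "card (atom ` \<Union>F) \<le> card (spine \<Phi>)"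
    using unsat_imp_dense_in_spine[OF fin unsat] by blast
  have "finite F" using F(1) fin(1) finite_subset by blast
  moreover have "F \<noteq> {}" using F(2) by auto
  then obtain C where C: "C \<in> F" by blast
  then have "card C = k" using F(1) \<Phi> by (auto simp: kclauses_def)
  then have "C \<noteq> {}" using assms(2) by auto
  \<comment> \<open>Nonempty clauses give the dense family at least one variable, so sparsity can
    only fail to cover it by its having more than \<open>m\<close> variables.\<close>
  ultimately have "0 < card (atom ` \<Union>F)"
    using C F(1) fin(2) by (auto simp: card_gt_0_iff)
  then have "\<not> card (atom ` \<Union>F) \<le> m"
    using F(1,2) sparse unfolding dense_upto_def by blast
  then show ?thesis using F(3) by linarith
qed

text \<open>The three error terms are satisfiability at \<open>p\<close>, the first moment bound at
  the capped probability, and the presence of a dense subformula on few variables.\<close>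

lemma prob_spine_ge:
  fixes k n :: nat and p :: real
  defines "A \<equiv> exp 2 * 2 ^ k :: real"
  assumes p: "0 \<le> p" "p \<le> 1" and k: "3 \<le> k" "k \<le> n"
  shows "1 - (measure_pmf.prob (random_ksat k n p) SAT + (2 / exp 1) ^ n + 2 * A / real n)
    \<le> measure_pmf.prob (random_ksat k n p) {\<Phi>. 1 / (4 * A) \<le> real (card (spine \<Phi>)) / real n}"
proof -
  \<comment> \<open>Chosen so that \<open>m \<le> \<eta> * n\<close> gives
    \<open>4 * A * m \<le> n\<close>, the hypothesis of \<open>prob_dense_upto_le\<close>.\<close>
  define \<eta> where "\<eta> = 1 / (4 * A)"
  define m where "m = nat \<lfloor>\<eta> * real n\<rfloor>"
  \<comment> \<open>Capping keeps the dense-subformula bound available. Where the cap is active, the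
    expected number of clauses on which a fixed assignment fails is \<open>n\<close>, so
    \<open>(1 - q) ^ (n choose k)\<close> is at most e^(-n), which beats the 2^n
    assignments.\<close>
  define q where "q = min p (real n / real (n choose k))"
  let ?P = "\<lambda>p. measure_pmf.prob (random_ksat k n p)"
  let ?S = "{\<Phi>. \<eta> \<le> real (card (spine \<Phi>)) / real n}"
  have A: "0 < A" by (simp add: A_def)
  have C: "0 < real (n choose k)" using k by simp
  have q: "0 \<le> q" "q \<le> p" "q \<le> 1" "q \<le> real n / real (n choose k)"
    using p by (auto simp: q_def)
  have "real m \<le> \<eta> * real n" using A by (simp add: m_def \<eta>_def)
  then have m: "4 * A * real m \<le> real n"
    using A by (simp add: \<eta>_def field_simps)
  have dense: "?P q (dense_upto m) \<le> 2 * A / real n"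
    using q k m unfolding A_def by (intro prob_dense_upto_le) auto
  have sat: "?P q SAT \<le> ?P p SAT + (2 / exp 1) ^ n"
  proof (cases "p \<le> real n / real (n choose k)")
    case True
    then show ?thesis by (simp add: q_def)
  next
    case False
    then have qC: "q * real (n choose k) = real n" using C by (simp add: q_def)
    have "?P q SAT \<le> 2 ^ n * (1 - q) ^ (n choose k)"
      using q by (intro prob_SAT_le) auto
    also have "\<dots> \<le> 2 ^ n * exp (- q) ^ (n choose k)"
      using q exp_ge_add_one_self[of "- q"] by (intro mult_left_mono power_mono) auto
    also have "exp (- q) ^ (n choose k) = exp (- real n)"
      using qC by (simp add: mult.commute flip: exp_of_nat_mult)
    also have "2 ^ n * exp (- real n) = (2 / exp 1) ^ n"
      by (simp add: power_divide exp_minus field_simps flip: exp_of_nat_mult)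
    finally show ?thesis by (simp add: add_increasing)
  qed
  have large: "\<Phi> \<in> ?S \<union> (SAT \<union> dense_upto m)" if "\<Phi> \<subseteq> kclauses k n" for \<Phi>
  proof (rule ccontr)
    assume *: "\<not> ?thesis"
    then have "m < card (spine \<Phi>)" using k that by (intro unsat_spine_large) auto
    \<comment> \<open>A spine smaller than \<open>\<eta> * n\<close> has integer size at most the
      floor \<open>m\<close>.\<close>
    moreover have "card (spine \<Phi>) \<le> m"
      unfolding m_def using * k by (intro le_nat_floor) (auto simp: field_simps)
    ultimately show False by simp
  qed
  have "1 = ?P q UNIV" by simp
  also have "\<dots> \<le> ?P q (?S \<union> (SAT \<union> dense_upto m))"
    using set_pmf_random_ksat[of k n q]
    by (intro measure_pmf.finite_measure_mono_AE AE_pmfI impI large) auto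
  also have "\<dots> \<le> ?P q ?S + ?P q (SAT \<union> dense_upto m)"
    by (rule measure_Un_le) auto
  also have "\<dots> \<le> ?P q ?S + (?P q SAT + ?P q (dense_upto m))"
    by (intro add_left_mono measure_Un_le) auto
  \<comment> \<open>Having a large spine is preserved by adding clauses, so the bound passes from
    \<open>q\<close> back to \<open>p\<close>.\<close>
  also have "?P q ?S \<le> ?P p ?S"
  proof (rule prob_random_ksat_mono)
    fix \<Phi> \<Psi> assume *: "\<Phi> \<subseteq> \<Psi>" "\<Psi> \<subseteq> kclauses k n" "\<Phi> \<in> ?S"
    have "finite (spine \<Psi>)"
      using *(2) finite_subset[OF *(2) finite_kclauses] by (intro finite_spine) (auto simp: kclauses_def)
    then have "card (spine \<Phi>) \<le> card (spine \<Psi>)"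
      using spine_mono[OF *(1)] by (rule card_mono)
    then have "real (card (spine \<Phi>)) / real n \<le> real (card (spine \<Psi>)) / real n"
      by (intro divide_right_mono) auto
    then show "\<Psi> \<in> ?S" using *(3) by simp
  qed (use q p in auto)
  finally show ?thesis using dense sat by (simp add: \<eta>_def)
qed

theorem theorem2:
  fixes k :: nat
  assumes "k \<ge> 3"
  shows "\<exists>\<eta>::real. \<eta> > 0 \<and>
    (\<forall>p :: nat \<Rightarrow> real. (\<forall>n. p n \<in> {0..1}) \<longrightarrow>
      (\<lambda>n. measure_pmf.prob (random_ksat k n (p n)) {\<Phi>. \<Phi> \<in> SAT}) \<longlonglongrightarrow> 0 \<longrightarrow>
      (\<lambda>n. measure_pmf.prob (random_ksat k n (p n))
             {\<Phi>. real (card (spine \<Phi>)) / real n \<ge> \<eta>}) \<longlonglongrightarrow> 1)"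
proof (intro exI conjI allI impI)
  define A where "A = exp 2 * (2::real) ^ k"
  show "0 < 1 / (4 * (exp 2 * (2::real) ^ k))" by simp
  fix p :: "nat \<Rightarrow> real"
  assume p: "\<forall>n. p n \<in> {0..1}"
    and lim: "(\<lambda>n. measure_pmf.prob (random_ksat k n (p n)) {\<Phi>. \<Phi> \<in> SAT}) \<longlonglongrightarrow> 0"
  have "(2::real) < exp 1"
    using exp_lower_Taylor_quadratic[of 1] by simp
  then have geo: "(\<lambda>n. (2 / exp 1 :: real) ^ n) \<longlonglongrightarrow> 0"
    by (intro LIMSEQ_power_zero) simp
  have "(\<lambda>n. 1 - (measure_pmf.prob (random_ksat k n (p n)) SAT + (2 / exp 1) ^ n
      + 2 * A / real n)) \<longlonglongrightarrow> 1 - (0 + 0 + 0)"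
    using lim unfolding Collect_mem_eq
    by (intro tendsto_diff tendsto_add tendsto_const geo lim_const_over_n)
  then have lower: "(\<lambda>n. 1 - (measure_pmf.prob (random_ksat k n (p n)) SAT + (2 / exp 1) ^ n
      + 2 * A / real n)) \<longlonglongrightarrow> 1" by simp
  show "(\<lambda>n. measure_pmf.prob (random_ksat k n (p n))
      {\<Phi>. 1 / (4 * (exp 2 * 2 ^ k)) \<le> real (card (spine \<Phi>)) / real n}) \<longlonglongrightarrow> 1"
  proof (rule tendsto_sandwich[OF _ _ lower tendsto_const])
    show "\<forall>\<^sub>F n in sequentially.
        1 - (measure_pmf.prob (random_ksat k n (p n)) SAT + (2 / exp 1) ^ n + 2 * A / real n)
        \<le> measure_pmf.prob (random_ksat k n (p n))
          {\<Phi>. 1 / (4 * (exp 2 * 2 ^ k)) \<le> real (card (spine \<Phi>)) / real n}"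
      \<comment> \<open>From \<open>n = k\<close> on, \<open>n choose k\<close> is positive and
        \<open>prob_spine_ge\<close> applies.\<close>
      using eventually_ge_at_top[of k]
    proof eventually_elim
      case (elim n)
      then show ?case
        unfolding A_def using p assms by (intro prob_spine_ge) auto
    qed
  qed simp
qed

end
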